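(* Let $W$ be a set of words in $\mathcal U^*$, all of the same length. Then $\sum_{\mathsf w\in W}\mathsf w\in I_{\mathrm S}^\perp$ if and only if $W$ is the vertex set of a switchboard.
   Context: $\mathcal U=\mathbb Z\langle u_1,\dots,u_N\rangle$; $\mathcal U^*$ is the free $\mathbb Z$-module on words in $\{1,\dots,N\}$ with pairing $\langle\mathbf u_{\mathsf w},\mathsf v\rangle=\delta_{\mathsf{vw}}$ where $\mathbf u_{\mathsf w}=u_{\mathsf w_1}\cdots u_{\mathsf w_n}$; $I^\perp$ is the annihilator of $I$. $I_{\mathrm S}$ is the two-sided ideal generated by $u_b^2u_a+u_au_bu_a-u_bu_au_b-u_bu_a^2$ ($b-a=1$), $u_b^2u_a-u_bu_au_b$ ($b-a\ge2$), $u_bu_a^2-u_au_bu_a$ ($b-a\ge2$), $u_bu_cu_a+u_au_cu_b-u_bu_au_c-u_cu_au_b$ ($a<b<c$). Two words $\mathsf w,\mathsf w'$ of length $n$ are related by a switch in position $i$ ($2\le i\le n-1$) if $\mathsf w_j=\mathsf w'_j$ for $j\notin\{i-1,i,i+1\}$ and the unordered pair $\{\mathsf w_{i-1}\mathsf w_i\mathsf w_{i+1},\mathsf w'_{i-1}\mathsf w'_i\mathsf w'_{i+1}\}$ is one of: $\{bac,bca\}$ or $\{acb,cab\}$ with $a<b<c$ (Knuth switch); $\{bac,acb\}$ or $\{bca,cab\}$ with $a<b<c$ (rotation switch); $\{bab,bba\}$ or $\{aba,baa\}$ with $a<b$ (Knuth switch); $\{bab,aba\}$ or $\{bba,baa\}$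 with $b=a+1$ (braid/idempotent switch). A switchboard is an edge-labeled graph on a vertex set of words of a fixed length $n$ in $\{1,\dots,N\}$, with edge labels in $\{2,\dots,n-1\}$, such that each edge labeled $i$ joins two words related by a switch in position $i$, and each vertex having exactly one descent among positions $i-1$ and $i$ (i.e. exactly one of $\mathsf w_{i-1}>\mathsf w_i$, $\mathsf w_i>\mathsf w_{i+1}$ holds) lies on exactly one edge labeled $i$. *)

theory Defs
  imports Main
begin

text \<open>Elements of the free algebra
  U = Z<u_1,...,u_N> are represented as finitely supported functions
  from words to integers (coefficient of the monomial u_w); elements of the
  dual module U^* likewise as integer-valued functions on words.\<close>

type_synonym word = "nat list"
type_synonym ncpoly = "word \<Rightarrow> int"

definition is_word :: "nat \<Rightarrow> word \<Rightarrow> bool" where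
  "is_word N w \<longleftrightarrow> set w \<subseteq> {1..N}"

definition supp :: "ncpoly \<Rightarrow> word set" where
  "supp p = {w. p w \<noteq> 0}"

definition in_U :: "nat \<Rightarrow> ncpoly \<Rightarrow> bool" where
  "in_U N p \<longleftrightarrow> finite (supp p) \<and> (\<forall>w\<in>supp p. is_word N w)"

definition mon :: "word \<Rightarrow> ncpoly" where
  "mon w = (\<lambda>v. if v = w then 1 else 0)"

definition ncadd :: "ncpoly \<Rightarrow> ncpoly \<Rightarrow> ncpoly" where
  "ncadd p q = (\<lambda>w. p w + q w)"

definition ncsub :: "ncpoly \<Rightarrow> ncpoly \<Rightarrow> ncpoly" where
  "ncsub p q = (\<lambda>w. p w - q w)"

definition ncmul :: "ncpoly \<Rightarrow> ncpoly \<Rightarrow> ncpoly" where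
  "ncmul p q = (\<lambda>w. \<Sum>i\<le>length w. p (take i w) * q (drop i w))"

definition IS_gens :: "nat \<Rightarrow> ncpoly set" where
  "IS_gens N =
     {ncsub (ncadd (mon [b,b,a]) (mon [a,b,a])) (ncadd (mon [b,a,b]) (mon [b,a,a]))
        | a b. 1 \<le> a \<and> b \<le> N \<and> b = a + 1}
   \<union> {ncsub (mon [b,b,a]) (mon [b,a,b]) | a b. 1 \<le> a \<and> b \<le> N \<and> b \<ge> a + 2}
   \<union> {ncsub (mon [b,a,a]) (mon [a,b,a]) | a b. 1 \<le> a \<and> b \<le> N \<and> b \<ge> a + 2}
   \<union> {ncsub (ncadd (mon [b,c,a]) (mon [a,c,b])) (ncadd (mon [b,a,c]) (mon [c,a,b]))
        | a b c. 1 \<le> a \<and> a < b \<and> b < c \<and> c \<le> N}"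

inductive_set IS_ideal :: "nat \<Rightarrow> ncpoly set" for N :: nat where
  gen: "r \<in> IS_gens N \<Longrightarrow> r \<in> IS_ideal N"
| zero: "(\<lambda>_. 0) \<in> IS_ideal N"
| add: "p \<in> IS_ideal N \<Longrightarrow> q \<in> IS_ideal N \<Longrightarrow> ncadd p q \<in> IS_ideal N"
| lmul: "in_U N a \<Longrightarrow> p \<in> IS_ideal N \<Longrightarrow> ncmul a p \<in> IS_ideal N"
| rmul: "in_U N a \<Longrightarrow> p \<in> IS_ideal N \<Longrightarrow> ncmul p a \<in> IS_ideal N"

definition pairing :: "ncpoly \<Rightarrow> ncpoly \<Rightarrow> int" where
  "pairing p f = (\<Sum>w\<in>supp p. p w * f w)"

definition IS_perp :: "nat \<Rightarrow> ncpoly set" where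
  "IS_perp N = {f. in_U N f \<and> (\<forall>p\<in>IS_ideal N. pairing p f = 0)}"

definition wsum :: "word set \<Rightarrow> ncpoly" where
  "wsum W = (\<lambda>v. \<Sum>w\<in>W. if v = w then 1 else 0)"

text \<open>1-indexed letter access: letter w j = w_j.\<close>
definition letter :: "word \<Rightarrow> nat \<Rightarrow> nat" where
  "letter w j = w ! (j - 1)"

definition triple_pair :: "nat \<times> nat \<times> nat \<Rightarrow> nat \<times> nat \<times> nat \<Rightarrow> bool" where
  "triple_pair t t' \<longleftrightarrow>
     (\<exists>a b c. a < b \<and> b < c \<and>
        ((t, t') = ((b,a,c), (b,c,a)) \<or> (t, t') = ((a,c,b), (c,a,b)) \<or>
         (t, t') = ((b,a,c), (a,c,b)) \<or> (t, t') = ((b,c,a), (c,a,b)))) \<or>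
     (\<exists>a b. a < b \<and>
        ((t, t') = ((b,a,b), (b,b,a)) \<or> (t, t') = ((a,b,a), (b,a,a)))) \<or>
     (\<exists>a b. b = a + 1 \<and>
        ((t, t') = ((b,a,b), (a,b,a)) \<or> (t, t') = ((b,b,a), (b,a,a))))"

definition triple_switch :: "nat \<times> nat \<times> nat \<Rightarrow> nat \<times> nat \<times> nat \<Rightarrow> bool" where
  "triple_switch t t' \<longleftrightarrow> triple_pair t t' \<or> triple_pair t' t"

definition triple_at :: "word \<Rightarrow> nat \<Rightarrow> nat \<times> nat \<times> nat" where
  "triple_at w i = (letter w (i - 1), letter w i, letter w (i + 1))"

definition switch :: "nat \<Rightarrow> nat \<Rightarrow> word \<Rightarrow> word \<Rightarrow> bool" where
  "switch n i w w' \<longleftrightarrow>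
     length w = n \<and> length w' = n \<and> 2 \<le> i \<and> i \<le> n - 1 \<and>
     (\<forall>j\<in>{1..n}. j \<notin> {i - 1, i, i + 1} \<longrightarrow> letter w j = letter w' j) \<and>
     triple_switch (triple_at w i) (triple_at w' i)"

definition descent :: "word \<Rightarrow> nat \<Rightarrow> bool" where
  "descent w j \<longleftrightarrow> letter w j > letter w (j + 1)"

text \<open>A switchboard: an edge-labelled graph with vertex set V (words of length n
  over {1..N}); each edge is a pair (e, i) with e = {w, w'} an unordered pair of
  vertices and label i in {2..n-1}.\<close>
definition switchboard :: "nat \<Rightarrow> nat \<Rightarrow> word set \<Rightarrow> (word set \<times> nat) set \<Rightarrow> bool" where
  "switchboard N n V E \<longleftrightarrow>
     (\<forall>w\<in>V. length w = n \<and> is_word N w) \<and>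
     (\<forall>(e, i)\<in>E. 2 \<le> i \<and> i \<le> n - 1 \<and>
        (\<exists>w w'. e = {w, w'} \<and> w \<in> V \<and> w' \<in> V \<and> switch n i w w')) \<and>
     (\<forall>w\<in>V. \<forall>i. 2 \<le> i \<and> i \<le> n - 1 \<and> (descent w (i - 1) \<noteq> descent w i) \<longrightarrow>
        (\<exists>!e. (e, i) \<in> E \<and> w \<in> e))"

end

theory Submission
  imports Defs
begin

text \<open>
  Pairing with \<open>\<Sum>w\<in>W. w\<close> kills the ideal \<open>I\<^sub>S\<close> iff it kills every generator inside every
  context \<open>u\<^sub>x \<cdot> _ \<cdot> u\<^sub>y\<close>. Each generator is a difference of two sets of monomials \<open>u\<^sub>t\<close> with
  \<open>t\<close> a triple, so this says that the set \<open>T\<close> of triples with \<open>x t y \<in> W\<close> meets both sides of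
  every relation equally often. The triples of a relation form a 4-cycle (or a single edge) of
  switches alternating between its two sides, and every switch stays inside one relation;
  hence this balance holds iff the one-descent triples of \<open>T\<close> are perfectly matched by
  switches. Such matchings, one for each context, are exactly the edges of a switchboard
  with a given label.
\<close>

section \<open>Sums of products over finite sets of words\<close>

lemma finite_factorizations:
  assumes "finite C"
  shows "finite {(u, v). u @ v \<in> C}"
proof -
  have "{(u, v). u @ v \<in> C} = (\<lambda>(w, i). (take i w, drop i w)) ` (SIGMA w:C. {..length w})"
  proof (intro set_eqI iffI)
    fix z assume "z \<in> {(u, v). u @ v \<in> C}"
    then show "z \<in> (\<lambda>(w, i). (take i w, drop i w)) ` (SIGMA w:C. {..length w})"
      by (auto intro!: image_eqI[of _ _ "(fst z @ snd z, length (fst z))"])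
  qed auto
  then show ?thesis
    using assms by simp
qed

lemma finite_left_factors:
  assumes "finite C"
  shows "finite {u. \<exists>v. u @ v \<in> C}"
proof -
  have "{u. \<exists>v. u @ v \<in> C} = fst ` {(u, v). u @ v \<in> C}"
    by force
  then show ?thesis
    using finite_factorizations[OF assms] by simp
qed

lemma finite_right_factors:
  assumes "finite C"
  shows "finite {v. \<exists>u. u @ v \<in> C}"
proof -
  have "{v. \<exists>u. u @ v \<in> C} = snd ` {(u, v). u @ v \<in> C}"
    by force
  then show ?thesis
    using finite_factorizations[OF assms] by simp
qed

lemma finite_left_quotient: "finite C \<Longrightarrow> finite {v. u @ v \<in> C}"
  using finite_vimageI[of C "(@) u"] by (simp add: vimage_def inj_def)

lemma finite_right_quotient: "finite C \<Longrightarrow> finite {u. u @ v \<in> C}"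
  using finite_vimageI[of C "\<lambda>u. u @ v"] by (simp add: vimage_def inj_def)

lemma sum_ncmul:
  assumes "finite C"
  shows "sum (ncmul p q) C = (\<Sum>(u, v) \<in> {(u, v). u @ v \<in> C}. p u * q v)"
proof -
  have "sum (ncmul p q) C = (\<Sum>(w, i) \<in> (SIGMA w:C. {..length w}). p (take i w) * q (drop i w))"
    unfolding ncmul_def by (rule sum.Sigma) (use assms in auto)
  also have "\<dots> = (\<Sum>(u, v) \<in> {(u, v). u @ v \<in> C}. p u * q v)"
    by (rule sum.reindex_bij_witness[where i = "\<lambda>(u, v). (u @ v, length u)"
          and j = "\<lambda>(w, i). (take i w, drop i w)"]) auto
  finally show ?thesis .
qed

lemma sum_ncmul_left:
  assumes "finite C"
  shows "sum (ncmul p q) C = (\<Sum>u | \<exists>v. u @ v \<in> C. p u * sum q {v. u @ v \<in> C})"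
proof -
  have "{(u, v). u @ v \<in> C} = (SIGMA u:{u. \<exists>v. u @ v \<in> C}. {v. u @ v \<in> C})"
    by auto
  then show ?thesis
    by (simp add: sum_ncmul[OF assms] sum_distrib_left
        sum.Sigma[OF finite_left_factors[OF assms] ballI[OF finite_left_quotient[OF assms]]])
qed

lemma sum_ncmul_right:
  assumes "finite C"
  shows "sum (ncmul p q) C = (\<Sum>v | \<exists>u. u @ v \<in> C. q v * sum p {u. u @ v \<in> C})"
proof -
  have "(\<Sum>v | \<exists>u. u @ v \<in> C. q v * sum p {u. u @ v \<in> C})
      = (\<Sum>(v, u) \<in> (SIGMA v:{v. \<exists>u. u @ v \<in> C}. {u. u @ v \<in> C}). p u * q v)"
    by (simp add: sum_distrib_left mult.commute
        sum.Sigma[OF finite_right_factors[OF assms] ballI[OF finite_right_quotient[OF assms]]])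
  also have "\<dots> = (\<Sum>(u, v) \<in> {(u, v). u @ v \<in> C}. p u * q v)"
    by (rule sum.reindex_bij_witness[where i = prod.swap and j = prod.swap]) auto
  finally show ?thesis
    by (simp add: sum_ncmul[OF assms])
qed

lemma sum_ncmul_mon_left:
  assumes "finite C"
  shows "sum (ncmul (mon u) p) C = sum p {v. u @ v \<in> C}"
proof -
  have "sum (ncmul (mon u) p) C
      = (\<Sum>u' | \<exists>v. u' @ v \<in> C. if u = u' then sum p {v. u' @ v \<in> C} else 0)"
    unfolding sum_ncmul_left[OF assms] by (rule sum.cong) (auto simp: mon_def)
  then show ?thesis
    using finite_left_factors[OF assms] by (auto simp: sum.delta)
qed

lemma sum_ncmul_mon_right:
  assumes "finite C"
  shows "sum (ncmul p (mon v)) C = sum p {u. u @ v \<in> C}"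
proof -
  have "sum (ncmul p (mon v)) C
      = (\<Sum>v' | \<exists>u. u @ v' \<in> C. if v = v' then sum p {u. u @ v' \<in> C} else 0)"
    unfolding sum_ncmul_right[OF assms] by (rule sum.cong) (auto simp: mon_def)
  then show ?thesis
    using finite_right_factors[OF assms] by (auto simp: sum.delta)
qed

lemma supp_ncmul: "supp (ncmul p q) \<subseteq> (\<lambda>(u, v). u @ v) ` (supp p \<times> supp q)"
proof
  fix w assume "w \<in> supp (ncmul p q)"
  then have "(\<Sum>i\<le>length w. p (take i w) * q (drop i w)) \<noteq> 0"
    by (simp add: supp_def ncmul_def)
  then obtain i where "p (take i w) * q (drop i w) \<noteq> 0"
    using sum.not_neutral_contains_not_neutral by blast
  then show "w \<in> (\<lambda>(u, v). u @ v) ` (supp p \<times> supp q)"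
    by (intro image_eqI[of _ _ "(take i w, drop i w)"]) (auto simp: supp_def)
qed

definition middles :: "word set \<Rightarrow> word \<Rightarrow> word \<Rightarrow> word set" where
  "middles W x y = {w. x @ w @ y \<in> W}"

lemma finite_middles: "finite W \<Longrightarrow> finite (middles W x y)"
  using finite_vimageI[of W "\<lambda>w. x @ w @ y"] by (simp add: middles_def vimage_def inj_def)

lemma left_quotient_middles [simp]: "{v. u @ v \<in> middles W x y} = middles W (x @ u) y"
  by (simp add: middles_def)

lemma right_quotient_middles [simp]: "{u. u @ v \<in> middles W x y} = middles W x (v @ y)"
  by (simp add: middles_def)

lemma middles_Nil [simp]: "middles W [] [] = W"
  by (simp add: middles_def)

lemma IS_ideal_sum_middles:
  assumes "finite W"
    and gens: "\<And>r x y. r \<in> IS_gens N \<Longrightarrow> sum r (middles W x y) = 0"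
    and "p \<in> IS_ideal N"
  shows "sum p (middles W x y) = 0"
  using assms(3)
proof (induction arbitrary: x y)
  case (gen r)
  then show ?case by (rule gens)
next
  case zero
  then show ?case by simp
next
  case (add p q)
  then show ?case by (simp add: ncadd_def sum.distrib)
next
  case (lmul a p)
  then show ?case by (simp add: sum_ncmul_left finite_middles[OF assms(1)])
next
  case (rmul a p)
  then show ?case by (simp add: sum_ncmul_right finite_middles[OF assms(1)])
qed

lemma wsum_eq: "finite W \<Longrightarrow> wsum W v = of_bool (v \<in> W)"
  by (simp add: wsum_def)

lemma pairing_wsum:
  assumes "finite W" and "finite (supp p)"
  shows "pairing p (wsum W) = sum p W"
proof -
  have "pairing p (wsum W) = (\<Sum>w \<in> supp p \<inter> W. p w)"
    using assms by (simp add: pairing_def wsum_eq Int_def)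
  also have "\<dots> = sum p W"
    by (rule sum.mono_neutral_left) (auto simp: assms supp_def)
  finally show ?thesis .
qed

section \<open>The generators of \<open>I\<^sub>S\<close> as balance conditions on triples\<close>

type_synonym triple = "nat \<times> nat \<times> nat"

fun word_of_triple :: "triple \<Rightarrow> word" where
  "word_of_triple (a, b, c) = [a, b, c]"

lemma length_word_of_triple [simp]: "length (word_of_triple t) = 3"
  by (cases t) simp

lemma word_of_triple_eq_iff [simp]: "word_of_triple t = word_of_triple t' \<longleftrightarrow> t = t'"
  by (cases t; cases t') simp

definition relation_pairs :: "nat \<Rightarrow> (triple set \<times> triple set) set" where
  "relation_pairs N =
     {({(b,b,a), (a,b,a)}, {(b,a,b), (b,a,a)}) | a b. 1 \<le> a \<and> b \<le> N \<and> b = a + 1}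
   \<union> {({(b,b,a)}, {(b,a,b)}) | a b. 1 \<le> a \<and> b \<le> N \<and> b \<ge> a + 2}
   \<union> {({(b,a,a)}, {(a,b,a)}) | a b. 1 \<le> a \<and> b \<le> N \<and> b \<ge> a + 2}
   \<union> {({(b,c,a), (a,c,b)}, {(b,a,c), (c,a,b)}) | a b c. 1 \<le> a \<and> a < b \<and> b < c \<and> c \<le> N}"

lemma finite_relation_pair: "(A, B) \<in> relation_pairs N \<Longrightarrow> finite A \<and> finite B"
  unfolding relation_pairs_def by (elim UnE CollectE exE conjE) simp_all

fun relation_poly :: "triple set \<times> triple set \<Rightarrow> ncpoly" where
  "relation_poly (A, B) =
     (\<lambda>w. of_bool (w \<in> word_of_triple ` A) - of_bool (w \<in> word_of_triple ` B))"

lemma relation_poly_doubleton: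
  "t \<noteq> t' \<Longrightarrow> s \<noteq> s' \<Longrightarrow> relation_poly ({t, t'}, {s, s'}) =
     ncsub (ncadd (mon (word_of_triple t)) (mon (word_of_triple t')))
       (ncadd (mon (word_of_triple s)) (mon (word_of_triple s')))"
  by (auto simp: fun_eq_iff ncadd_def ncsub_def mon_def)

lemma relation_poly_singleton:
  "relation_poly ({t}, {s}) = ncsub (mon (word_of_triple t)) (mon (word_of_triple s))"
  by (auto simp: fun_eq_iff ncsub_def mon_def)

lemma setcompr2_image_cong:
  "(\<And>a b. P a b \<Longrightarrow> f a b = h (g a b)) \<Longrightarrow> {f a b | a b. P a b} = h ` {g a b | a b. P a b}"
  by (auto simp: image_def) metis

lemma setcompr3_image_cong:
  "(\<And>a b c. P a b c \<Longrightarrow> f a b c = h (g a b c)) \<Longrightarrow>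
    {f a b c | a b c. P a b c} = h ` {g a b c | a b c. P a b c}"
  by (auto simp: image_def) metis

lemma IS_gens_eq: "IS_gens N = relation_poly ` relation_pairs N"
  unfolding IS_gens_def relation_pairs_def image_Un
  by (intro arg_cong2[where f = "(\<union>)"] setcompr2_image_cong setcompr3_image_cong)
    (simp_all del: relation_poly.simps add: relation_poly_doubleton relation_poly_singleton)

lemma supp_relation_poly: "supp (relation_poly (A, B)) \<subseteq> word_of_triple ` (A \<union> B)"
  by (auto simp: supp_def)

lemma finite_supp_IS_ideal: "p \<in> IS_ideal N \<Longrightarrow> finite (supp p)"
proof (induction rule: IS_ideal.induct)
  case (gen r)
  then obtain A B where "(A, B) \<in> relation_pairs N" "r = relation_poly (A, B)"
    by (auto simp: IS_gens_eq)
  then show ?case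
    using supp_relation_poly finite_relation_pair by (metis finite_Un finite_imageI finite_subset)
next
  case zero
  then show ?case by (simp add: supp_def)
next
  case (add p q)
  have "supp (ncadd p q) \<subseteq> supp p \<union> supp q"
    by (auto simp: supp_def ncadd_def)
  then show ?case using add.IH finite_subset by blast
next
  case (lmul a p)
  then show ?case
    using finite_subset[OF supp_ncmul] by (simp add: in_U_def)
next
  case (rmul a p)
  then show ?case
    using finite_subset[OF supp_ncmul] by (simp add: in_U_def)
qed

definition context_triples :: "word set \<Rightarrow> word \<Rightarrow> word \<Rightarrow> triple set" where
  "context_triples W x y = {t. x @ word_of_triple t @ y \<in> W}"

lemma context_triples_bounded:
  assumes "\<forall>w\<in>W. is_word N w"
  shows "context_triples W x y \<subseteq> {1..N} \<times> {1..N} \<times> {1..N}"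
  using assms by (auto simp: context_triples_def is_word_def)

definition balanced :: "nat \<Rightarrow> triple set \<Rightarrow> bool" where
  "balanced N T \<longleftrightarrow> (\<forall>(A, B) \<in> relation_pairs N. card (A \<inter> T) = card (B \<inter> T))"

lemma sum_relation_poly_middles:
  assumes "finite W" "finite A" "finite B"
  shows "sum (relation_poly (A, B)) (middles W x y)
    = int (card (A \<inter> context_triples W x y)) - int (card (B \<inter> context_triples W x y))"
proof -
  have card_eq:
    "card (middles W x y \<inter> {w. w \<in> word_of_triple ` X}) = card (X \<inter> context_triples W x y)" for X
  proof -
    have "middles W x y \<inter> {w. w \<in> word_of_triple ` X}
        = word_of_triple ` (X \<inter> context_triples W x y)"
      by (auto simp: middles_def context_triples_def)
    then show ?thesis
      by (simp add: card_image inj_on_def)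
  qed
  have "sum (relation_poly (A, B)) (middles W x y)
      = (\<Sum>w \<in> middles W x y. of_bool (w \<in> word_of_triple ` A))
        - (\<Sum>w \<in> middles W x y. of_bool (w \<in> word_of_triple ` B))"
    by (simp add: sum_subtractf)
  then show ?thesis
    using finite_middles[OF assms(1)] by (simp only: sum_of_bool_eq card_eq)
qed

lemma IS_gens_annihilate_middles_iff_balanced:
  assumes "finite W"
  shows "(\<forall>r \<in> IS_gens N. \<forall>x y. sum r (middles W x y) = 0)
    \<longleftrightarrow> (\<forall>x y. balanced N (context_triples W x y))"
proof -
  have "sum (relation_poly (A, B)) (middles W x y) = 0
      \<longleftrightarrow> card (A \<inter> context_triples W x y) = card (B \<inter> context_triples W x y)"
    if "(A, B) \<in> relation_pairs N" for A B x y
    using finite_relation_pair[OF that]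
    by (simp del: relation_poly.simps add: sum_relation_poly_middles[OF assms])
  then show ?thesis
    unfolding IS_gens_eq balanced_def by fast
qed

lemma wsum_in_IS_perp_iff_balanced:
  assumes "finite W" and words: "\<forall>w\<in>W. is_word N w"
  shows "wsum W \<in> IS_perp N \<longleftrightarrow> (\<forall>x y. balanced N (context_triples W x y))"
  unfolding IS_gens_annihilate_middles_iff_balanced[OF assms(1), symmetric]
proof (intro iffI ballI allI)
  fix r x y
  assume perp: "wsum W \<in> IS_perp N" and r: "r \<in> IS_gens N"
  show "sum r (middles W x y) = 0"
  proof (cases "is_word N x \<and> is_word N y")
    case True
    let ?p = "ncmul (mon x) (ncmul r (mon y))"
    have p: "?p \<in> IS_ideal N"
      using True r by (intro IS_ideal.lmul IS_ideal.rmul IS_ideal.gen)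
        (simp_all add: in_U_def supp_def mon_def)
    have "0 = pairing ?p (wsum W)"
      using perp p by (simp add: IS_perp_def)
    also have "\<dots> = sum ?p W"
      by (rule pairing_wsum) (use assms(1) finite_supp_IS_ideal[OF p] in auto)
    also have "\<dots> = sum (ncmul r (mon y)) {v. x @ v \<in> W}"
      by (rule sum_ncmul_mon_left[OF assms(1)])
    also have "\<dots> = sum r (middles W x y)"
      by (simp add: sum_ncmul_mon_right finite_left_quotient[OF assms(1)] middles_def)
    finally show ?thesis ..
  next
    case False
    then have "middles W x y = {}"
      using words unfolding middles_def is_word_def by fastforce
    then show ?thesis by simp
  qed
next
  assume gens: "\<forall>r\<in>IS_gens N. \<forall>x y. sum r (middles W x y) = 0"
  have "in_U N (wsum W)"
    using assms by (simp add: in_U_def supp_def wsum_eq)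
  moreover have "pairing p (wsum W) = 0" if "p \<in> IS_ideal N" for p
    using IS_ideal_sum_middles[OF assms(1) _ that, of "[]" "[]"] gens
      pairing_wsum[OF assms(1) finite_supp_IS_ideal[OF that]]
    by simp
  ultimately show "wsum W \<in> IS_perp N"
    by (simp add: IS_perp_def)
qed

section \<open>Switches of triples\<close>

definition one_descent :: "triple \<Rightarrow> bool" where
  "one_descent t \<longleftrightarrow> (case t of (p, q, r) \<Rightarrow> (q < p) \<noteq> (r < q))"

fun knuth_partner :: "triple \<Rightarrow> triple" where
  "knuth_partner (p, q, r) = (if q < p \<and> p \<le> r \<or> r < p \<and> p \<le> q then (p, r, q) else (q, p, r))"

text \<open>The rotation switch for three distinct letters, the braid or idempotent switch otherwise.\<close>

fun other_partner :: "triple \<Rightarrow> triple" where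
  "other_partner (p, q, r) =
     (if p \<noteq> q \<and> q \<noteq> r \<and> p \<noteq> r then
        (if q < p \<and> p < r \<or> r < p \<and> p < q then (q, r, p) else (r, p, q))
      else if p = r then (q, p, q) else if p = q then (p, r, r) else (p, p, q))"

fun has_other_partner :: "triple \<Rightarrow> bool" where
  "has_other_partner (p, q, r) \<longleftrightarrow>
     p \<noteq> q \<and> q \<noteq> r \<and> p \<noteq> r \<or> p = r \<and> (q = p + 1 \<or> p = q + 1) \<or>
     p = q \<and> p = r + 1 \<or> q = r \<and> p = q + 1"

lemma one_descent_cases:
  assumes "one_descent (p, q, r)"
  obtains "q < p" "p < r" | "r < p" "p < q" | "p < r" "r < q" | "q < r" "r < p"
    | "q < p" "p = r" | "p < q" "p = r" | "r < p" "p = q" | "q < p" "q = r"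
  using assms unfolding one_descent_def
  by (cases p r rule: linorder_cases; cases q r rule: linorder_cases;
      cases p q rule: linorder_cases) auto

lemma triple_pair_intros:
  "a < b \<Longrightarrow> b < c \<Longrightarrow> triple_pair (b,a,c) (b,c,a)"
  "a < b \<Longrightarrow> b < c \<Longrightarrow> triple_pair (a,c,b) (c,a,b)"
  "a < b \<Longrightarrow> b < c \<Longrightarrow> triple_pair (b,a,c) (a,c,b)"
  "a < b \<Longrightarrow> b < c \<Longrightarrow> triple_pair (b,c,a) (c,a,b)"
  "a < b \<Longrightarrow> triple_pair (b,a,b) (b,b,a)"
  "a < b \<Longrightarrow> triple_pair (a,b,a) (b,a,a)"
  "b = a + 1 \<Longrightarrow> triple_pair (b,a,b) (a,b,a)"
  "b = a + 1 \<Longrightarrow> triple_pair (b,b,a) (b,a,a)"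
  unfolding triple_pair_def by blast+

lemma triple_switch_knuth_partner: "one_descent t \<Longrightarrow> triple_switch t (knuth_partner t)"
  by (cases t) (auto elim!: one_descent_cases intro: triple_pair_intros simp: triple_switch_def)

lemma knuth_partner_involutive: "one_descent t \<Longrightarrow> knuth_partner (knuth_partner t) = t"
  by (cases t) (auto simp: one_descent_def)

lemma triple_switch_other_partner:
  "one_descent t \<Longrightarrow> has_other_partner t \<Longrightarrow> triple_switch t (other_partner t)"
  by (cases t) (auto elim!: one_descent_cases intro: triple_pair_intros simp: triple_switch_def)

lemma other_partner_involutive:
  "one_descent t \<Longrightarrow> has_other_partner t \<Longrightarrow> other_partner (other_partner t) = t"
  by (cases t) (auto simp: one_descent_def)

lemma triple_switch_sym: "triple_switch t t' \<longleftrightarrow> triple_switch t' t"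
  by (auto simp: triple_switch_def)

lemma triple_switch_one_descent: "triple_switch t t' \<Longrightarrow> one_descent t"
  by (auto simp: triple_switch_def triple_pair_def one_descent_def)

lemma triple_switch_neq: "triple_switch t t' \<Longrightarrow> t \<noteq> t'"
  by (auto simp: triple_switch_def triple_pair_def)

lemma triple_switch_cases:
  assumes "triple_switch t t'"
  shows "t' = knuth_partner t \<or> has_other_partner t \<and> t' = other_partner t"
  using assms unfolding triple_switch_def triple_pair_def by auto

lemma relation_pair_switch_closed:
  assumes "(A, B) \<in> relation_pairs N"
  shows "\<forall>t\<in>A \<union> B. one_descent t"
    and "\<forall>t\<in>A. \<forall>t'. triple_switch t t' \<longrightarrow> t' \<in> B"
    and "\<forall>t\<in>B. \<forall>t'. triple_switch t t' \<longrightarrow> t' \<in> A"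
proof -
  have "(\<forall>t\<in>A. one_descent t \<and> knuth_partner t \<in> B \<and> (has_other_partner t \<longrightarrow> other_partner t \<in> B))
      \<and> (\<forall>t\<in>B. one_descent t \<and> knuth_partner t \<in> A \<and> (has_other_partner t \<longrightarrow> other_partner t \<in> A))"
    using assms unfolding relation_pairs_def
    by (elim UnE CollectE exE conjE) (simp_all add: one_descent_def)
  then show "\<forall>t\<in>A \<union> B. one_descent t"
    and "\<forall>t\<in>A. \<forall>t'. triple_switch t t' \<longrightarrow> t' \<in> B"
    and "\<forall>t\<in>B. \<forall>t'. triple_switch t t' \<longrightarrow> t' \<in> A"
    using triple_switch_cases by blast+
qed

definition switch_matching :: "triple set \<Rightarrow> (triple \<Rightarrow> triple) \<Rightarrow> bool" where
  "switch_matching T f \<longleftrightarrow>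
     (\<forall>t\<in>T. one_descent t \<longrightarrow> f t \<in> T \<and> triple_switch t (f t) \<and> f (f t) = t)"

lemma switch_matching_imp_balanced:
  assumes "switch_matching T f"
  shows "balanced N T"
  unfolding balanced_def
proof (clarify)
  fix A B assume AB: "(A, B) \<in> relation_pairs N"
  note closed = relation_pair_switch_closed[OF AB]
  have "bij_betw f (A \<inter> T) (B \<inter> T)"
    using assms closed unfolding switch_matching_def
    by (intro bij_betw_byWitness[where f' = f]) blast+
  then show "card (A \<inter> T) = card (B \<inter> T)"
    by (rule bij_betw_same_card)
qed

lemma balanced_relations:
  assumes "balanced N T"
  shows "1 \<le> a \<Longrightarrow> b \<le> N \<Longrightarrow> b = a + 1 \<Longrightarrow>
      of_bool ((b,b,a) \<in> T) + of_bool ((a,b,a) \<in> T)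
        = of_bool ((b,a,b) \<in> T) + (of_bool ((b,a,a) \<in> T) :: nat)"
    and "1 \<le> a \<Longrightarrow> b \<le> N \<Longrightarrow> a + 2 \<le> b \<Longrightarrow> (b,b,a) \<in> T \<longleftrightarrow> (b,a,b) \<in> T"
    and "1 \<le> a \<Longrightarrow> b \<le> N \<Longrightarrow> a + 2 \<le> b \<Longrightarrow> (b,a,a) \<in> T \<longleftrightarrow> (a,b,a) \<in> T"
    and "1 \<le> a \<Longrightarrow> a < b \<Longrightarrow> b < c \<Longrightarrow> c \<le> N \<Longrightarrow>
      of_bool ((b,c,a) \<in> T) + of_bool ((a,c,b) \<in> T)
        = of_bool ((b,a,c) \<in> T) + (of_bool ((c,a,b) \<in> T) :: nat)"
proof -
  have card: "card (A \<inter> T) = card (B \<inter> T)" if "(A, B) \<in> relation_pairs N" for A B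
    using assms that unfolding balanced_def by blast
  have pair: "card ({t, t'} \<inter> T) = of_bool (t \<in> T) + of_bool (t' \<in> T)" if "t \<noteq> t'" for t t'
    using that by (auto simp: Int_insert_left)
  have single: "card ({t} \<inter> T) = of_bool (t \<in> T)" for t
    by (auto simp: Int_insert_left)
  have "({(b,b,a), (a,b,a)}, {(b,a,b), (b,a,a)}) \<in> relation_pairs N"
    if "1 \<le> a" "b \<le> N" "b = a + 1" for a b
    using that unfolding relation_pairs_def by blast
  from card[OF this] show "1 \<le> a \<Longrightarrow> b \<le> N \<Longrightarrow> b = a + 1 \<Longrightarrow>
      of_bool ((b,b,a) \<in> T) + of_bool ((a,b,a) \<in> T)
        = of_bool ((b,a,b) \<in> T) + (of_bool ((b,a,a) \<in> T) :: nat)"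
    by (simp add: pair)
  have "({(b,b,a)}, {(b,a,b)}) \<in> relation_pairs N" "({(b,a,a)}, {(a,b,a)}) \<in> relation_pairs N"
    if "1 \<le> a" "b \<le> N" "a + 2 \<le> b" for a b
    using that unfolding relation_pairs_def by blast+
  from card[OF this(1)] card[OF this(2)]
  show "1 \<le> a \<Longrightarrow> b \<le> N \<Longrightarrow> a + 2 \<le> b \<Longrightarrow> (b,b,a) \<in> T \<longleftrightarrow> (b,a,b) \<in> T"
    and "1 \<le> a \<Longrightarrow> b \<le> N \<Longrightarrow> a + 2 \<le> b \<Longrightarrow> (b,a,a) \<in> T \<longleftrightarrow> (a,b,a) \<in> T"
    by (simp_all add: single of_bool_eq_iff)
  have "({(b,c,a), (a,c,b)}, {(b,a,c), (c,a,b)}) \<in> relation_pairs N"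
    if "1 \<le> a" "a < b" "b < c" "c \<le> N" for a b c
    using that unfolding relation_pairs_def by blast
  from card[OF this] show "1 \<le> a \<Longrightarrow> a < b \<Longrightarrow> b < c \<Longrightarrow> c \<le> N \<Longrightarrow>
      of_bool ((b,c,a) \<in> T) + of_bool ((a,c,b) \<in> T)
        = of_bool ((b,a,c) \<in> T) + (of_bool ((c,a,b) \<in> T) :: nat)"
    by (simp add: pair)
qed

lemma balanced_other_partner:
  assumes bal: "balanced N T" and range: "T \<subseteq> {1..N} \<times> {1..N} \<times> {1..N}"
    and od: "one_descent (p, q, r)" and t: "(p, q, r) \<in> T"
    and knuth: "knuth_partner (p, q, r) \<notin> T"
  shows "has_other_partner (p, q, r) \<and> other_partner (p, q, r) \<in> T
    \<and> knuth_partner (other_partner (p, q, r)) \<notin> T"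
proof -
  have bounds: "1 \<le> p" "p \<le> N" "1 \<le> q" "q \<le> N" "1 \<le> r" "r \<le> N"
    using range t by auto
  note rel = balanced_relations[OF bal]
  \<comment> \<open>Both switch partners of \<open>t\<close> lie on the other side of the relation through \<open>t\<close>;
    balance forces the other partner into \<open>T\<close> and keeps its Knuth partner out.\<close>
  from od show ?thesis
  proof (cases rule: one_descent_cases)
    case 1
    then show ?thesis
      using rel(4)[of q p r] bounds t knuth by (auto simp: of_bool_def split: if_splits)
  next
    case 2
    then show ?thesis
      using rel(4)[of r p q] bounds t knuth by (auto simp: of_bool_def split: if_splits)
  next
    case 3
    then show ?thesis
      using rel(4)[of p r q] bounds t knuth by (auto simp: of_bool_def split: if_splits)
  next
    case 4
    then show ?thesis
      using rel(4)[of q r p] bounds t knuth by (auto simp: of_bool_def split: if_splits)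
  next
    case 5
    then show ?thesis
      using rel(1,2)[of q p] bounds t knuth
      by (cases "p = q + 1") (auto simp: of_bool_def split: if_splits)
  next
    case 6
    then show ?thesis
      using rel(1,3)[of p q] bounds t knuth
      by (cases "q = p + 1") (auto simp: of_bool_def split: if_splits)
  next
    case 7
    then show ?thesis
      using rel(1,2)[of r p] bounds t knuth
      by (cases "p = r + 1") (auto simp: of_bool_def split: if_splits)
  next
    case 8
    then show ?thesis
      using rel(1,3)[of q p] bounds t knuth
      by (cases "p = q + 1") (auto simp: of_bool_def split: if_splits)
  qed
qed

definition balanced_matching :: "triple set \<Rightarrow> triple \<Rightarrow> triple" where
  "balanced_matching T t = (if knuth_partner t \<in> T then knuth_partner t else other_partner t)"

lemma switch_matching_balanced_matching:
  assumes bal: "balanced N T" and range: "T \<subseteq> {1..N} \<times> {1..N} \<times> {1..N}"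
  shows "switch_matching T (balanced_matching T)"
  unfolding switch_matching_def
proof (intro ballI impI)
  fix t assume t: "t \<in> T" and od: "one_descent t"
  obtain p q r where pqr: "t = (p, q, r)"
    by (cases t)
  show "balanced_matching T t \<in> T \<and> triple_switch t (balanced_matching T t)
      \<and> balanced_matching T (balanced_matching T t) = t"
  proof (cases "knuth_partner t \<in> T")
    case True
    then show ?thesis
      using triple_switch_knuth_partner[OF od] knuth_partner_involutive[OF od] t
      by (simp add: balanced_matching_def del: knuth_partner.simps)
  next
    case False
    then have "has_other_partner t" "other_partner t \<in> T" "knuth_partner (other_partner t) \<notin> T"
      using balanced_other_partner[OF bal range] od t pqr by blast+
    then show ?thesis
      using False triple_switch_other_partner[OF od] other_partner_involutive[OF od]
      by (simp add: balanced_matching_def del: knuth_partner.simps other_partner.simps)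
  qed
qed

lemma balanced_iff_switch_matching:
  assumes "T \<subseteq> {1..N} \<times> {1..N} \<times> {1..N}"
  shows "balanced N T \<longleftrightarrow> (\<exists>f. switch_matching T f)"
  using switch_matching_balanced_matching[OF _ assms] switch_matching_imp_balanced by blast

section \<open>Switchboards\<close>

lemma triple_at_append: "i = length x + 2 \<Longrightarrow> triple_at (x @ word_of_triple t @ y) i = t"
  by (cases t) (simp add: triple_at_def letter_def nth_append)

lemma descent_change_append_iff:
  "descent (x @ word_of_triple t @ y) (length x + 2 - 1)
      \<noteq> descent (x @ word_of_triple t @ y) (length x + 2)
    \<longleftrightarrow> one_descent t"
  by (cases t) (simp add: descent_def letter_def nth_append one_descent_def)

lemma split_at_triple:
  assumes "length w = n" "2 \<le> i" "i \<le> n - 1"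
  shows "w = take (i - 2) w @ word_of_triple (triple_at w i) @ drop (i + 1) w"
proof -
  define k where "k = i - 2"
  have k: "Suc (Suc (Suc k)) \<le> length w" "i = Suc (Suc k)"
    using assms by (auto simp: k_def)
  have drop: "drop k w = w ! k # w ! Suc k # w ! Suc (Suc k) # drop (Suc (Suc (Suc k))) w"
    using k(1) by (simp add: Cons_nth_drop_Suc)
  have triple: "triple_at w i = (w ! k, w ! Suc k, w ! Suc (Suc k))"
    using k by (simp add: triple_at_def letter_def)
  have "w = take k w @ drop k w"
    by simp
  also have "\<dots> = take k w @ word_of_triple (triple_at w i) @ drop (Suc (Suc (Suc k))) w"
    by (simp only: drop triple word_of_triple.simps append_Cons append_Nil)
  also have "\<dots> = take (i - 2) w @ word_of_triple (triple_at w i) @ drop (i + 1) w"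
    using k(2) by simp
  finally show ?thesis .
qed

lemma switch_sym: "switch n i w w' \<longleftrightarrow> switch n i w' w"
  unfolding switch_def using triple_switch_sym by metis

lemma switch_append_iff:
  "switch n (length x + 2) (x @ word_of_triple t @ y) w' \<longleftrightarrow>
    length x + 3 + length y = n \<and> (\<exists>t'. w' = x @ word_of_triple t' @ y \<and> triple_switch t t')"
    (is "switch n ?i ?w w' \<longleftrightarrow> _")
proof
  assume S: "switch n ?i ?w w'"
  then have len_w: "length ?w = n" and len: "length w' = n"
    and same: "\<forall>j\<in>{1..n}. j \<notin> {?i - 1, ?i, ?i + 1} \<longrightarrow> letter ?w j = letter w' j"
    and "triple_switch (triple_at ?w ?i) (triple_at w' ?i)"
    unfolding switch_def by blast+
  then have ts: "triple_switch t (triple_at w' ?i)"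
    by (simp only: triple_at_append[OF refl])
  have n: "n = length x + 3 + length y"
    using len_w by simp
  have "take (length x) w' = x"
  proof (rule nth_equalityI)
    fix k assume "k < length (take (length x) w')"
    then have "k < length x" by simp
    moreover from this have "letter ?w (k + 1) = letter w' (k + 1)"
      using same n by auto
    ultimately show "take (length x) w' ! k = x ! k"
      by (simp add: letter_def nth_append)
  qed (use len n in simp)
  moreover have "drop (length x + 3) w' = y"
  proof (rule nth_equalityI)
    fix k assume "k < length (drop (length x + 3) w')"
    then have "k < length y"
      using len n by simp
    moreover from this have "letter ?w (length x + 4 + k) = letter w' (length x + 4 + k)"
      using same n by auto
    ultimately show "drop (length x + 3) w' ! k = y ! k"
      using len n by (simp add: letter_def nth_append add.commute add.left_commute)
  qed (use len n in simp)
  ultimately have "w' = x @ word_of_triple (triple_at w' ?i) @ y"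
    using split_at_triple[OF len, of ?i] n by (simp add: numeral_3_eq_3)
  then show "length x + 3 + length y = n
      \<and> (\<exists>t'. w' = x @ word_of_triple t' @ y \<and> triple_switch t t')"
    using n ts by blast
next
  assume "length x + 3 + length y = n \<and> (\<exists>t'. w' = x @ word_of_triple t' @ y \<and> triple_switch t t')"
  then obtain t' where n: "length x + 3 + length y = n" and w': "w' = x @ word_of_triple t' @ y"
    and ts: "triple_switch t t'"
    by blast
  have "letter ?w j = letter w' j" if "j \<in> {1..n}" "j \<notin> {?i - 1, ?i, ?i + 1}" for j
  proof -
    have "j - 1 < length x \<or> length x + 3 \<le> j - 1"
      using that by auto
    then show ?thesis
      using w' by (auto simp: letter_def nth_append)
  qed
  then show "switch n ?i ?w w'"
    unfolding switch_def using n ts w' triple_at_append[OF refl, of x _ y] by auto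
qed

lemma switchboardD:
  assumes "switchboard N n W E"
  shows "w \<in> W \<Longrightarrow> length w = n"
    and "(e, i) \<in> E \<Longrightarrow> \<exists>w w'. e = {w, w'} \<and> w \<in> W \<and> w' \<in> W \<and> switch n i w w'"
    and "w \<in> W \<Longrightarrow> 2 \<le> i \<Longrightarrow> i \<le> n - 1 \<Longrightarrow> descent w (i - 1) \<noteq> descent w i
      \<Longrightarrow> \<exists>!e. (e, i) \<in> E \<and> w \<in> e"
  using assms unfolding switchboard_def by fast+

lemma switchboard_edge_other_end:
  assumes "switchboard N n W E" "(e, i) \<in> E" "w \<in> e"
  obtains w' where "e = {w, w'}" "w' \<in> W" "switch n i w w'"
proof -
  obtain u u' where uu: "e = {u, u'}" "u \<in> W" "u' \<in> W" "switch n i u u'"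
    using switchboardD(2)[OF assms(1,2)] by blast
  show ?thesis
  proof (cases "w = u")
    case True
    then show ?thesis using that uu by blast
  next
    case False
    then have "w = u'" using uu(1) assms(3) by blast
    then show ?thesis using that uu switch_sym[of n i u u'] by (simp add: insert_commute)
  qed
qed

lemma switchboard_unique_edge_at_context:
  assumes sb: "switchboard N n W E"
    and t: "t \<in> context_triples W x y" "one_descent t"
  shows "\<exists>!e. (e, length x + 2) \<in> E \<and> x @ word_of_triple t @ y \<in> e"
proof -
  have w: "x @ word_of_triple t @ y \<in> W"
    using t(1) by (simp add: context_triples_def)
  then have "length (x @ word_of_triple t @ y) = n"
    by (rule switchboardD(1)[OF sb])
  then show ?thesis
    using switchboardD(3)[OF sb w] t(2) descent_change_append_iff[of x t y] by simp
qed

lemma switchboard_switch_at_context: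
  assumes sb: "switchboard N n W E"
    and t: "t \<in> context_triples W x y" "one_descent t"
  shows "\<exists>t'. t' \<in> context_triples W x y \<and> triple_switch t t'
    \<and> ({x @ word_of_triple t @ y, x @ word_of_triple t' @ y}, length x + 2) \<in> E"
proof -
  obtain e where e: "(e, length x + 2) \<in> E" "x @ word_of_triple t @ y \<in> e"
    using switchboard_unique_edge_at_context[OF sb t] by blast
  then obtain w' where w': "e = {x @ word_of_triple t @ y, w'}" "w' \<in> W"
    "switch n (length x + 2) (x @ word_of_triple t @ y) w'"
    by (rule switchboard_edge_other_end[OF sb])
  then obtain t' where t': "w' = x @ word_of_triple t' @ y" "triple_switch t t'"
    unfolding switch_append_iff by blast
  then have "t' \<in> context_triples W x y"
    using w'(2) by (simp add: context_triples_def)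
  then show ?thesis
    using t' w'(1) e(1) by blast
qed

lemma switchboard_imp_switch_matching:
  assumes sb: "switchboard N n W E"
  shows "\<exists>f. switch_matching (context_triples W x y) f"
proof -
  let ?T = "context_triples W x y" and ?i = "length x + 2"
  let ?w = "\<lambda>t. x @ word_of_triple t @ y"
  define f where "f t = (SOME t'. t' \<in> ?T \<and> triple_switch t t' \<and> ({?w t, ?w t'}, ?i) \<in> E)" for t
  have f: "f t \<in> ?T \<and> triple_switch t (f t) \<and> ({?w t, ?w (f t)}, ?i) \<in> E"
    if "t \<in> ?T" "one_descent t" for t
    unfolding f_def by (rule someI_ex[OF switchboard_switch_at_context[OF sb that]])
  have "f (f t) = t" if t: "t \<in> ?T" "one_descent t" for t
  proof -
    have "f t \<in> ?T" "triple_switch (f t) t" "t \<noteq> f t"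
      using f[OF t] triple_switch_sym triple_switch_neq by auto
    then have s: "f t \<in> ?T" "one_descent (f t)" "?w t \<noteq> ?w (f t)"
      using triple_switch_one_descent by auto
    \<comment> \<open>both edges contain the vertex of \<open>f t\<close>, so they coincide\<close>
    have "{?w (f t), ?w (f (f t))} = {?w t, ?w (f t)}"
      using switchboard_unique_edge_at_context[OF sb s(1,2)] f[OF s(1,2)] f[OF t]
      by (metis insert_commute insertI1)
    then have "?w (f (f t)) = ?w t"
      using s(3) by (auto simp: doubleton_eq_iff)
    then show ?thesis
      by simp
  qed
  then have "switch_matching ?T f"
    using f by (simp add: switch_matching_def)
  then show ?thesis
    by blast
qed

lemma obtain_split_at_triple:
  assumes "length w = n" "2 \<le> i" "i \<le> n - 1"
  obtains x y where "w = x @ word_of_triple (triple_at w i) @ y" "i = length x + 2"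
proof (rule that)
  show "w = take (i - 2) w @ word_of_triple (triple_at w i) @ drop (i + 1) w"
    by (rule split_at_triple[OF assms])
  show "i = length (take (i - 2) w) + 2"
    using assms by simp
qed

lemma descent_change_iff_one_descent:
  assumes "length w = n" "2 \<le> i" "i \<le> n - 1"
  shows "descent w (i - 1) \<noteq> descent w i \<longleftrightarrow> one_descent (triple_at w i)"
proof -
  obtain x y where w: "w = x @ word_of_triple (triple_at w i) @ y" and i: "i = length x + 2"
    using obtain_split_at_triple[OF assms] .
  show ?thesis
    using descent_change_append_iff[of x "triple_at w i" y] by (simp only: flip: w i)
qed

definition switch_partner :: "(word \<Rightarrow> word \<Rightarrow> triple \<Rightarrow> triple) \<Rightarrow> word \<Rightarrow> nat \<Rightarrow> word" where
  "switch_partner F w i =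
     take (i - 2) w
     @ word_of_triple (F (take (i - 2) w) (drop (i + 1) w) (triple_at w i))
     @ drop (i + 1) w"

lemma switch_partner_append:
  "i = length x + 2 \<Longrightarrow>
    switch_partner F (x @ word_of_triple t @ y) i = x @ word_of_triple (F x y t) @ y"
  by (simp add: switch_partner_def triple_at_append numeral_3_eq_3)

lemma switch_partner_props:
  assumes F: "\<And>x y. switch_matching (context_triples W x y) (F x y)"
    and lengths: "\<forall>w\<in>W. length w = n"
    and w: "w \<in> W" and i: "2 \<le> i" "i \<le> n - 1" and od: "one_descent (triple_at w i)"
  shows "switch_partner F w i \<in> W \<and> switch n i w (switch_partner F w i)
    \<and> switch_partner F (switch_partner F w i) i = w"
proof -
  have len: "length w = n"
    using lengths w by blast
  obtain x y where w_split: "w = x @ word_of_triple (triple_at w i) @ y"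
    and i_eq: "i = length x + 2"
    using obtain_split_at_triple[OF len i] .
  define t where "t = triple_at w i"
  have w_eq: "w = x @ word_of_triple t @ y"
    using w_split by (simp only: t_def)
  have "t \<in> context_triples W x y"
    using w w_eq by (simp add: context_triples_def)
  then have m: "F x y t \<in> context_triples W x y" "triple_switch t (F x y t)" "F x y (F x y t) = t"
    using F[of x y] od by (auto simp: switch_matching_def t_def)
  have p: "switch_partner F w i = x @ word_of_triple (F x y t) @ y"
    unfolding w_eq by (rule switch_partner_append[OF i_eq])
  have "switch n i w (x @ word_of_triple (F x y t) @ y)"
    unfolding w_eq i_eq switch_append_iff using len w_eq m(2) by auto
  then have "switch n i w (switch_partner F w i)"
    by (simp only: p)
  moreover have "switch_partner F (switch_partner F w i) i = w"
    unfolding p using switch_partner_append[OF i_eq] m(3) w_eq by simp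
  ultimately show ?thesis
    using m(1) p by (simp add: context_triples_def)
qed

lemma switch_matchings_imp_switchboard:
  assumes words: "\<forall>w\<in>W. length w = n \<and> is_word N w"
    and F: "\<And>x y. switch_matching (context_triples W x y) (F x y)"
  shows "switchboard N n W
    {({w, switch_partner F w i}, i) | w i. w \<in> W \<and> 2 \<le> i \<and> i \<le> n - 1 \<and> one_descent (triple_at w i)}"
proof -
  define E where "E = {({w, switch_partner F w i}, i) | w i.
    w \<in> W \<and> 2 \<le> i \<and> i \<le> n - 1 \<and> one_descent (triple_at w i)}"
  have lengths: "\<forall>w\<in>W. length w = n"
    using words by blast
  note partner = switch_partner_props[OF F lengths]
  have edges: "2 \<le> i \<and> i \<le> n - 1 \<and> (\<exists>w w'. e = {w, w'} \<and> w \<in> W \<and> w' \<in> W \<and> switch n i w w')"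
    if e: "(e, i) \<in> E" for e i
  proof -
    obtain w where "e = {w, switch_partner F w i}" "w \<in> W" "2 \<le> i" "i \<le> n - 1"
      "one_descent (triple_at w i)"
      using e by (auto simp: E_def)
    then show ?thesis
      using partner by blast
  qed
  have unique: "\<exists>!e. (e, i) \<in> E \<and> w \<in> e"
    if w: "w \<in> W" and i: "2 \<le> i" "i \<le> n - 1" and desc: "descent w (i - 1) \<noteq> descent w i" for w i
  proof (rule ex1I)
    have "one_descent (triple_at w i)"
      using desc descent_change_iff_one_descent[of w n i] lengths w i by blast
    then show "({w, switch_partner F w i}, i) \<in> E \<and> w \<in> {w, switch_partner F w i}"
      using w i by (auto simp: E_def)
  next
    fix e assume "(e, i) \<in> E \<and> w \<in> e"
    then obtain w0 where e: "e = {w0, switch_partner F w0 i}"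
      and w: "w = w0 \<or> w = switch_partner F w0 i"
      and "w0 \<in> W" "one_descent (triple_at w0 i)"
      by (auto simp: E_def)
    then have "switch_partner F (switch_partner F w0 i) i = w0"
      using partner i by blast
    with e w show "e = {w, switch_partner F w i}"
      by auto
  qed
  have "switchboard N n W E"
    unfolding switchboard_def
  proof (intro conjI)
    show "\<forall>(e, i)\<in>E. 2 \<le> i \<and> i \<le> n - 1 \<and>
        (\<exists>w w'. e = {w, w'} \<and> w \<in> W \<and> w' \<in> W \<and> switch n i w w')"
      using edges by blast
  qed (use words unique in blast)+
  then show ?thesis
    by (simp only: E_def)
qed

lemma switchboard_iff_switch_matchings:
  assumes "\<forall>w\<in>W. length w = n \<and> is_word N w"
  shows "(\<exists>E. switchboard N n W E) \<longleftrightarrow> (\<forall>x y. \<exists>f. switch_matching (context_triples W x y) f)"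
proof
  assume "\<forall>x y. \<exists>f. switch_matching (context_triples W x y) f"
  then obtain F where "\<And>x y. switch_matching (context_triples W x y) (F x y)"
    by metis
  then show "\<exists>E. switchboard N n W E"
    using switch_matchings_imp_switchboard[OF assms] by blast
qed (use switchboard_imp_switch_matching in blast)

theorem proposition3p3:
  fixes N n :: nat and W :: "word set"
  assumes "finite W"
    and "\<forall>w\<in>W. length w = n \<and> is_word N w"
  shows "wsum W \<in> IS_perp N \<longleftrightarrow> (\<exists>E. switchboard N n W E)"
proof -
  have words: "\<forall>w\<in>W. is_word N w"
    using assms(2) by blast
  have "wsum W \<in> IS_perp N \<longleftrightarrow> (\<forall>x y. balanced N (context_triples W x y))"
    by (rule wsum_in_IS_perp_iff_balanced[OF assms(1) words])
  also have "\<dots> \<longleftrightarrow> (\<forall>x y. \<exists>f. switch_matching (context_triples W x y) f)"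
    using balanced_iff_switch_matching[OF context_triples_bounded[OF words]] by blast
  also have "\<dots> \<longleftrightarrow> (\<exists>E. switchboard N n W E)"
    by (rule switchboard_iff_switch_matchings[OF assms(2), symmetric])
  finally show ?thesis .
qed

end
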